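(* Let $1<p<\infty$ and let $\Omega$ and $\widetilde{\Omega}$ be open subsets of $M$. For each $D\in\{\Omega,\widetilde\Omega\}$, let $\lambda_1(D)$ be the principal frequency of $\mathcal{L}_p$ in $D$, and assume that there is a corresponding positive eigenfunction, i.e. a positive function $u_{1,D}\in \mathring{S}^{1,p}(D)$ such that $$\int_{D} |\nabla_X u_{1,D}|^{p-2}\langle \nabla_X u_{1,D},\nabla_X\phi\rangle\, dx=\lambda_1(D)\int_D |u_{1,D}|^{p-2}u_{1,D}\,\phi\, dx\quad\text{for every }\phi\in \mathring{S}^{1,p}(D).$$ If $\Omega\subset\widetilde\Omega$, then $$\lambda_1(\Omega)\ge\lambda_1(\widetilde\Omega).$$
   Context: $M$ is a smooth manifold of dimension $n$ with a volume form $dx$, and $\{X_k\}_{k=1}^N$, $N\le n$, is a family of vector fields on $M$, $X_k=\sum_{j=1}^n a_{kj}(x)\frac{\partial}{\partial x_j}$, with formal adjoints $X_k^*$. Write $\nabla_X=(X_1,\dots,X_N)$, $\nabla_X^*=(X_1^*,\dots,X_N^* )$, let $\langle\cdot,\cdot\rangle$ be the Euclidean inner product on $\mathbb{R}^N$, and $|\nabla_X u|=\left(\sum_{k=1}^N (X_ku)^2\right)^{1/2}$. The $p$-sub-Laplacian is $\mathcal{L}_p f=\nabla_X^*\cdot(|\nabla_X f|^{p-2}\nabla_X f)$. For an open set $D\subset M$, $\mathring{S}^{1,p}(D)$ is the completion of $C_0^1(D)$ in the norm generated by $J_p(u)=\left(\int_D|\nabla_X u|^p dx\right)^{1/p}$;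 functions are real-valued. The principal Dirichlet frequency (first eigenvalue) of $\mathcal{L}_p$ in $D$ is $$\lambda_1(D):=\min_{u\in\mathring{S}^{1,p}(D)}\left\{\int_D|\nabla_X u|^p dx:\ \int_D|u|^p dx=1\right\}.$$ *)

theory Defs
  imports "HOL-Analysis.Analysis"
begin

section \<open>Smooth manifolds\<close>

text \<open>The manifold is the type \<open>'m\<close> itself, its dimension is \<open>CARD('n)\<close>. A chart is a pair of
  its domain and its coordinate map (which is arbitrary outside the domain).\<close>

type_synonym ('m, 'n) chart = "'m set \<times> ('m \<Rightarrow> real ^ 'n)"

abbreviation cdom :: "('m, 'n) chart \<Rightarrow> 'm set" where "cdom \<equiv> fst"
abbreviation cmap :: "('m, 'n) chart \<Rightarrow> 'm \<Rightarrow> real ^ 'n" where "cmap \<equiv> snd"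
abbreviation cimage :: "('m, 'n) chart \<Rightarrow> (real ^ 'n) set" where "cimage c \<equiv> cmap c ` cdom c"

definition cinv :: "('m, 'n) chart \<Rightarrow> real ^ 'n \<Rightarrow> 'm" where
  "cinv c = inv_into (cdom c) (cmap c)"

definition is_chart :: "('m::topological_space, 'n::finite) chart \<Rightarrow> bool" where
  "is_chart c \<longleftrightarrow> open (cdom c) \<and> open (cimage c) \<and>
     homeomorphism (cdom c) (cimage c) (cmap c) (cinv c)"

definition pderiv_at :: "'n::finite \<Rightarrow> (real ^ 'n \<Rightarrow> 'b::real_normed_vector) \<Rightarrow> real ^ 'n \<Rightarrow> 'b" where
  "pderiv_at j f y = frechet_derivative f (at y) (axis j 1)"

text \<open>\<open>Ck_on k S f\<close> is only meant for open \<open>S\<close>.\<close>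

primrec Ck_on :: "nat \<Rightarrow> (real ^ 'n) set \<Rightarrow> (real ^ 'n::finite \<Rightarrow> 'b::real_normed_vector) \<Rightarrow> bool" where
  "Ck_on 0 S f \<longleftrightarrow> continuous_on S f"
| "Ck_on (Suc k) S f \<longleftrightarrow>
     (\<forall>y\<in>S. f differentiable (at y)) \<and> (\<forall>j. Ck_on k S (pderiv_at j f))"

definition smooth_on :: "(real ^ 'n) set \<Rightarrow> (real ^ 'n::finite \<Rightarrow> 'b::real_normed_vector) \<Rightarrow> bool" where
  "smooth_on S f \<longleftrightarrow> (\<forall>k. Ck_on k S f)"

definition transition :: "('m, 'n) chart \<Rightarrow> ('m, 'n) chart \<Rightarrow> real ^ 'n \<Rightarrow> real ^ 'n" where
  "transition c d = cmap d \<circ> cinv c"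

definition transition_jacobian :: "('m, 'n::finite) chart \<Rightarrow> ('m, 'n) chart \<Rightarrow> 'm \<Rightarrow> real ^ 'n ^ 'n" where
  "transition_jacobian c d x = matrix (frechet_derivative (transition c d) (at (cmap c x)))"

definition smooth_atlas :: "('m::topological_space, 'n::finite) chart set \<Rightarrow> bool" where
  "smooth_atlas A \<longleftrightarrow> (\<forall>c\<in>A. is_chart c) \<and> (\<Union>c\<in>A. cdom c) = UNIV \<and>
     (\<forall>c\<in>A. \<forall>d\<in>A. smooth_on (cmap c ` (cdom c \<inter> cdom d)) (transition c d))"

definition C1_manifold :: "('m::topological_space, 'n::finite) chart set \<Rightarrow> ('m \<Rightarrow> real) \<Rightarrow> bool" where
  "C1_manifold A f \<longleftrightarrow> (\<forall>c\<in>A. Ck_on 1 (cimage c) (f \<circ> cinv c))"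

text \<open>\<open>C_0^1(D)\<close>, each function being extended by zero to the whole manifold.\<close>

definition C01 :: "('m::topological_space, 'n::finite) chart set \<Rightarrow> 'm set \<Rightarrow> ('m \<Rightarrow> real) set" where
  "C01 A D = {f. C1_manifold A f \<and> compact (closure {x. f x \<noteq> 0}) \<and> closure {x. f x \<noteq> 0} \<subseteq> D}"


section \<open>Volume forms and vector fields\<close>

text \<open>An \<open>n\<close>-form is given by its components: in the chart \<open>c\<close> it is
  \<open>w c x dx\<^sub>1 \<and> \<dots> \<and> dx\<^sub>n\<close> at the point \<open>x\<close>.\<close>

definition volume_form ::
  "('m::topological_space, 'n::finite) chart set \<Rightarrow> (('m, 'n) chart \<Rightarrow> 'm \<Rightarrow> real) \<Rightarrow> bool" where
  "volume_form A w \<longleftrightarrow>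
     (\<forall>c\<in>A. smooth_on (cimage c) (w c \<circ> cinv c) \<and> (\<forall>x\<in>cdom c. w c x \<noteq> 0)) \<and>
     (\<forall>c\<in>A. \<forall>d\<in>A. \<forall>x\<in>cdom c \<inter> cdom d. w c x = w d x * det (transition_jacobian c d x))"

text \<open>The Borel measure of integration against \<open>w\<close>, the manifold carrying the orientation
  defined by \<open>w\<close>. On a second countable manifold it is determined by \<open>A\<close> and \<open>w\<close>.\<close>

definition volume_measure ::
  "('m::topological_space, 'n::finite) chart set \<Rightarrow> (('m, 'n) chart \<Rightarrow> 'm \<Rightarrow> real) \<Rightarrow> 'm measure \<Rightarrow> bool" where
  "volume_measure A w \<mu> \<longleftrightarrow> sets \<mu> = sets borel \<and>
     (\<forall>c\<in>A. \<forall>B\<in>sets borel. B \<subseteq> cdom c \<longrightarrow>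
        emeasure \<mu> B = (\<integral>\<^sup>+ y\<in>cmap c ` B. ennreal \<bar>w c (cinv c y)\<bar> \<partial>lborel))"

text \<open>A vector field is given by its coefficients: in the chart \<open>c\<close> it is
  \<open>\<Sum>\<^sub>j (V c x $ j) \<partial>/\<partial>x\<^sub>j\<close> at the point \<open>x\<close>. The coefficients are \<open>C\<^sup>1\<close>, so that the formal
  adjoint \<open>X\<^sup>*\<close> is a first order differential operator; smooth fields are a special case.\<close>

definition vector_field ::
  "('m::topological_space, 'n::finite) chart set \<Rightarrow> (('m, 'n) chart \<Rightarrow> 'm \<Rightarrow> real ^ 'n) \<Rightarrow> bool" where
  "vector_field A V \<longleftrightarrow>
     (\<forall>c\<in>A. Ck_on 1 (cimage c) (V c \<circ> cinv c)) \<and>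
     (\<forall>c\<in>A. \<forall>d\<in>A. \<forall>x\<in>cdom c \<inter> cdom d. V d x = transition_jacobian c d x *v V c x)"

definition vf_in_chart ::
  "(('m, 'n::finite) chart \<Rightarrow> 'm \<Rightarrow> real ^ 'n) \<Rightarrow> ('m, 'n) chart \<Rightarrow> ('m \<Rightarrow> real) \<Rightarrow> 'm \<Rightarrow> real" where
  "vf_in_chart V c f x = (\<Sum>j\<in>UNIV. V c x $ j * pderiv_at j (f \<circ> cinv c) (cmap c x))"

text \<open>The choice of the chart is immaterial, see \<open>vf_apply_eq\<close> below.\<close>

definition vf_apply :: "('m, 'n::finite) chart set \<Rightarrow> (('m, 'n) chart \<Rightarrow> 'm \<Rightarrow> real ^ 'n) \<Rightarrow>
    ('m \<Rightarrow> real) \<Rightarrow> 'm \<Rightarrow> real" where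
  "vf_apply A V f x = vf_in_chart V (SOME c. c \<in> A \<and> x \<in> cdom c) f x"

lemma vf_in_chart_eq:
  assumes A: "smooth_atlas A" and V: "vector_field A V" and f: "C1_manifold A f"
    and c: "c \<in> A" "x \<in> cdom c" and d: "d \<in> A" "x \<in> cdom d"
  shows "vf_in_chart V c f x = vf_in_chart V d f x"
proof -
  define y where "y = cmap c x"
  define T where "T = transition c d"
  have hc: "homeomorphism (cdom c) (cimage c) (cmap c) (cinv c)" "open (cdom c)" "open (cimage c)"
    and hd: "homeomorphism (cdom d) (cimage d) (cmap d) (cinv d)" "open (cdom d)"
    using A c d by (auto simp: smooth_atlas_def is_chart_def)
  have inv: "cinv c y = x" "T y = cmap d x"
    using hc c by (auto simp: y_def T_def transition_def homeomorphism_def)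
  have cont: "continuous_on (cimage c) (cinv c)"
    using hc by (simp add: homeomorphism_def)
  define S where "S = cimage c \<inter> cinv c -` cdom d"
  have S: "open S" "y \<in> S"
    using continuous_open_preimage[OF cont hc(3) hd(2)] c d inv by (auto simp: S_def y_def)
  have "smooth_on (cmap c ` (cdom c \<inter> cdom d)) T"
    using A c d by (auto simp: smooth_atlas_def T_def)
  then have "Ck_on (Suc 0) (cmap c ` (cdom c \<inter> cdom d)) T"
    unfolding smooth_on_def by blast
  then have T: "T differentiable (at y)" using c d by (simp add: y_def)
  have fd: "(f \<circ> cinv d) differentiable (at (T y))"
    using f d inv by (auto simp: C1_manifold_def)
  define DT where "DT = frechet_derivative T (at y)"
  define Df where "Df = frechet_derivative (f \<circ> cinv d) (at (T y))"
  have DT: "(T has_derivative DT) (at y)" and Df: "((f \<circ> cinv d) has_derivative Df) (at (T y))"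
    using T fd by (auto simp: DT_def Df_def frechet_derivative_works)
  have comp: "((f \<circ> cinv d) \<circ> T has_derivative Df \<circ> DT) (at y)"
    by (rule diff_chain_at[OF DT Df])
  have eq: "((f \<circ> cinv d) \<circ> T) z = (f \<circ> cinv c) z" if "z \<in> S" for z
    using that hd by (auto simp: S_def T_def transition_def homeomorphism_def)
  have "((f \<circ> cinv c) has_derivative Df \<circ> DT) (at y)"
    by (rule has_derivative_transform_within_open[OF comp S eq])
  then have fc: "frechet_derivative (f \<circ> cinv c) (at y) = Df \<circ> DT"
    by (metis frechet_derivative_at)
  have lin: "linear DT" "linear Df"
    using DT Df by (auto intro: has_derivative_linear)
  have sum: "L v = (\<Sum>j\<in>UNIV. v $ j * L (axis j 1))" if "linear L" for L :: "real ^ 'b \<Rightarrow> real" and v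
  proof -
    have "v = (\<Sum>j\<in>UNIV. (v $ j) *\<^sub>R axis j 1)"
      using basis_expansion[of v] by (simp only: scalar_mult_eq_scaleR)
    then have "L v = L (\<Sum>j\<in>UNIV. (v $ j) *\<^sub>R axis j 1)" by (rule arg_cong)
    also have "\<dots> = (\<Sum>j\<in>UNIV. (v $ j) *\<^sub>R L (axis j 1))"
      by (simp only: linear_sum[OF that] linear_cmul[OF that])
    finally show ?thesis by (simp only: real_scaleR_def)
  qed
  have "vf_in_chart V c f x = Df (DT (V c x))"
    using sum[OF linear_compose[OF lin], of "V c x"]
    by (simp add: vf_in_chart_def pderiv_at_def fc y_def[symmetric])
  moreover have "V d x = DT (V c x)"
  proof -
    have "V d x = transition_jacobian c d x *v V c x"
      using V c d unfolding vector_field_def by blast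
    also have "transition_jacobian c d x = matrix DT"
      by (simp only: transition_jacobian_def DT_def T_def y_def)
    finally show ?thesis by (simp only: fun_cong[OF matrix_vector_mul(2)[OF lin(1)]])
  qed
  moreover have "vf_in_chart V d f x = Df (V d x)"
    using sum[OF lin(2), of "V d x"]
    by (simp only: vf_in_chart_def pderiv_at_def Df_def inv(2)[symmetric])
  ultimately show ?thesis by simp
qed

lemma vf_apply_eq:
  assumes "smooth_atlas A" "vector_field A V" "C1_manifold A f" "c \<in> A" "x \<in> cdom c"
  shows "vf_apply A V f x = vf_in_chart V c f x"
proof -
  have "(SOME c. c \<in> A \<and> x \<in> cdom c) \<in> A \<and> x \<in> cdom (SOME c. c \<in> A \<and> x \<in> cdom c)"
    by (rule someI[where x = c]) (use assms in auto)
  then show ?thesis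
    unfolding vf_apply_def using assms by (intro vf_in_chart_eq[of A]) auto
qed

type_synonym ('m, 'n, 'k) vf_family = "'k \<Rightarrow> ('m, 'n) chart \<Rightarrow> 'm \<Rightarrow> real ^ 'n"

text \<open>\<open>\<nabla>\<^sub>X f = (X\<^sub>1 f, \<dots>, X\<^sub>N f)\<close> with \<open>N = CARD('k)\<close>\<close>

definition nablaX :: "('m, 'n::finite) chart set \<Rightarrow> ('m, 'n, 'k::finite) vf_family \<Rightarrow>
    ('m \<Rightarrow> real) \<Rightarrow> 'm \<Rightarrow> real ^ 'k" where
  "nablaX A X f x = (\<chi> k. vf_apply A (X k) f x)"


section \<open>The completion of \<open>C_0^1(D)\<close> and the principal frequency\<close>

definition Jp :: "('m, 'n::finite) chart set \<Rightarrow> ('m, 'n, 'k::finite) vf_family \<Rightarrow> 'm measure \<Rightarrow>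
    real \<Rightarrow> 'm set \<Rightarrow> ('m \<Rightarrow> real) \<Rightarrow> real" where
  "Jp A X \<mu> p D f = (LINT x:D|\<mu>. norm (nablaX A X f x) powr p) powr (1 / p)"

definition Jp_Cauchy :: "('m, 'n::finite) chart set \<Rightarrow> ('m, 'n, 'k::finite) vf_family \<Rightarrow> 'm measure \<Rightarrow>
    real \<Rightarrow> 'm set \<Rightarrow> (nat \<Rightarrow> 'm \<Rightarrow> real) \<Rightarrow> bool" where
  "Jp_Cauchy A X \<mu> p D f \<longleftrightarrow>
     (\<forall>e>0. \<exists>K. \<forall>i\<ge>K. \<forall>j\<ge>K. Jp A X \<mu> p D (\<lambda>x. f i x - f j x) < e)"

text \<open>An element of the completion of \<open>C_0^1(D)\<close> is the class of a \<open>J\<^sub>p\<close>-Cauchy sequence in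
  \<open>C_0^1(D)\<close>, and \<open>\<nabla>\<^sub>X\<close> extends to it as the \<open>L\<^sup>p(D)\<close>-limit \<open>g\<close> of the gradients of the sequence;
  in turn the almost everywhere class of \<open>g\<close> determines the element. To speak of
  the element as a function \<open>u\<close> on \<open>D\<close> we use the functional completion in the sense of Aronszajn
  and Smith: \<open>u\<close> is the almost everywhere limit of a representing sequence. No Poincare
  inequality or closability of \<open>\<nabla>\<^sub>X\<close> is presupposed; therefore the function and its gradient
  are kept together, as pairs \<open>(u, g)\<close> with \<open>g = \<nabla>\<^sub>X u\<close>. Only the values of \<open>u\<close> and \<open>g\<close> on
  \<open>D\<close> matter.\<close>

definition S0 :: "('m::topological_space, 'n::finite) chart set \<Rightarrow> ('m, 'n, 'k::finite) vf_family \<Rightarrow>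
    'm measure \<Rightarrow> real \<Rightarrow> 'm set \<Rightarrow> (('m \<Rightarrow> real) \<times> ('m \<Rightarrow> real ^ 'k)) set" where
  "S0 A X \<mu> p D = {(u, g).
     set_borel_measurable \<mu> D u \<and> set_borel_measurable \<mu> D g \<and>
     (\<exists>f. (\<forall>i. f i \<in> C01 A D) \<and> Jp_Cauchy A X \<mu> p D f \<and>
        (AE x in \<mu>. x \<in> D \<longrightarrow> (\<lambda>i. f i x) \<longlonglongrightarrow> u x) \<and>
        (\<lambda>i. \<integral>\<^sup>+ x\<in>D. ennreal (norm (nablaX A X (f i) x - g x) powr p) \<partial>\<mu>) \<longlonglongrightarrow> 0)}"

text \<open>\<open>l\<close> is the minimum defining the principal frequency of the \<open>p\<close>-sub-Laplacian in \<open>D\<close>. As a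
  Bochner integral with value \<open>1\<close> exists, the constraint contains \<open>u \<in> L\<^sup>p(D)\<close>.\<close>

definition rayleigh_values :: "('m::topological_space, 'n::finite) chart set \<Rightarrow>
    ('m, 'n, 'k::finite) vf_family \<Rightarrow> 'm measure \<Rightarrow> real \<Rightarrow> 'm set \<Rightarrow> real set" where
  "rayleigh_values A X \<mu> p D =
     {(LINT x:D|\<mu>. norm (g x) powr p) | u g.
        (u, g) \<in> S0 A X \<mu> p D \<and> (LINT x:D|\<mu>. \<bar>u x\<bar> powr p) = 1}"

definition is_principal_frequency :: "('m::topological_space, 'n::finite) chart set \<Rightarrow>
    ('m, 'n, 'k::finite) vf_family \<Rightarrow> 'm measure \<Rightarrow> real \<Rightarrow> 'm set \<Rightarrow> real \<Rightarrow> bool" where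
  "is_principal_frequency A X \<mu> p D l \<longleftrightarrow>
     l \<in> rayleigh_values A X \<mu> p D \<and> (\<forall>r\<in>rayleigh_values A X \<mu> p D. l \<le> r)"

text \<open>Where \<open>g x = 0\<close> and \<open>p < 2\<close>, the vector \<open>|g|\<^bsup>p-2\<^esup> g\<close> is \<open>0\<close>, as usual; likewise for \<open>u\<close>.
  The left integrand is integrable by Hoelder's inequality; for the right one this is part
  of the meaning of the equation, as \<open>\<phi>\<close> need not be in \<open>L\<^sup>p(D)\<close>.\<close>

definition positive_eigenfunction :: "('m::topological_space, 'n::finite) chart set \<Rightarrow>
    ('m, 'n, 'k::finite) vf_family \<Rightarrow> 'm measure \<Rightarrow> real \<Rightarrow> 'm set \<Rightarrow> real \<Rightarrow>
    ('m \<Rightarrow> real) \<Rightarrow> ('m \<Rightarrow> real ^ 'k) \<Rightarrow> bool" where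
  "positive_eigenfunction A X \<mu> p D l u g \<longleftrightarrow>
     (u, g) \<in> S0 A X \<mu> p D \<and> (AE x in \<mu>. x \<in> D \<longrightarrow> 0 < u x) \<and>
     (\<forall>(\<phi>, h) \<in> S0 A X \<mu> p D.
        set_integrable \<mu> D (\<lambda>x. \<bar>u x\<bar> powr (p - 2) * u x * \<phi> x) \<and>
        (LINT x:D|\<mu>. norm (g x) powr (p - 2) * (g x \<bullet> h x)) =
          l * (LINT x:D|\<mu>. \<bar>u x\<bar> powr (p - 2) * u x * \<phi> x))"

end

theory Submission
  imports Defs
begin

text \<open>Extension by zero embeds \<open>S0(\<Omega>)\<close> into \<open>S0(\<Omega>')\<close> and preserves both integrals of the
  Rayleigh quotient, so the minimum over \<open>\<Omega>'\<close> is taken over a larger set of values. At the level of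
  the approximating \<open>C\<^sub>0\<^sup>1\<close> functions nothing is to be extended: their gradients vanish off
  the support, hence off \<open>\<Omega>\<close>.\<close>

lemma C01_mono: "D \<subseteq> E \<Longrightarrow> C01 A D \<subseteq> C01 A E"
  unfolding C01_def by blast

text \<open>Differential operators are local: in the very chart that \<open>vf_apply\<close> chooses
  at \<open>x\<close>, the function \<open>f \<circ> cinv c\<close> agrees with zero on an open
  neighbourhood of \<open>cmap c x\<close>, so its derivative there is zero.\<close>

lemma nablaX_eq_0:
  assumes A: "smooth_atlas A" and U: "open U" "x \<in> U" and f: "\<And>z. z \<in> U \<Longrightarrow> f z = 0"
  shows "nablaX A X f x = 0"
proof -
  define c where "c = (SOME c. c \<in> A \<and> x \<in> cdom c)"
  have "x \<in> (\<Union>c\<in>A. cdom c)"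
    using A by (simp add: smooth_atlas_def)
  then have "\<exists>c. c \<in> A \<and> x \<in> cdom c" by blast
  then have c: "c \<in> A" "x \<in> cdom c"
    unfolding c_def by (metis (mono_tags, lifting) someI_ex)+
  then have hom: "homeomorphism (cdom c) (cimage c) (cmap c) (cinv c)" and op: "open (cimage c)"
    using A by (auto simp: smooth_atlas_def is_chart_def)
  define S where "S = cimage c \<inter> cinv c -` U"
  have "open S"
    unfolding S_def using hom op U by (intro continuous_open_preimage) (auto simp: homeomorphism_def)
  moreover have "cmap c x \<in> S"
    using hom c U by (auto simp: S_def homeomorphism_def)
  ultimately have "((f \<circ> cinv c) has_derivative (\<lambda>_. 0)) (at (cmap c x))"
    by (rule has_derivative_transform_within_open[OF has_derivative_const]) (simp add: S_def f)
  then have "frechet_derivative (f \<circ> cinv c) (at (cmap c x)) = (\<lambda>_. 0)"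
    by (metis frechet_derivative_at)
  then show ?thesis
    by (simp add: nablaX_def vf_apply_def c_def[symmetric] vf_in_chart_def pderiv_at_def vec_eq_iff)
qed

lemma C01_eq_0: "f \<in> C01 A D \<Longrightarrow> x \<notin> D \<Longrightarrow> f x = 0"
  using closure_subset[of "{x. f x \<noteq> 0}"] unfolding C01_def by blast

text \<open>Meant for the Cauchy condition, which concerns gradients of differences. The complement
  of \<open>D\<close> need not be open; that of the two closed supports is, and it contains every
  point off \<open>D\<close>.\<close>

lemma nablaX_diff_C01_eq_0:
  assumes A: "smooth_atlas A" and f: "f \<in> C01 A D" and g: "g \<in> C01 A D" and x: "x \<notin> D"
  shows "nablaX A X (\<lambda>x. f x - g x) x = 0"
proof (rule nablaX_eq_0[OF A])
  let ?U = "- (closure {x. f x \<noteq> 0} \<union> closure {x. g x \<noteq> 0})"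
  show "open ?U" by blast
  show "x \<in> ?U" using f g x unfolding C01_def by blast
  show "f z - g z = 0" if "z \<in> ?U" for z
  proof -
    have "f z = 0" "g z = 0"
      using that closure_subset[of "{x. f x \<noteq> 0}"] closure_subset[of "{x. g x \<noteq> 0}"] by blast+
    then show ?thesis by simp
  qed
qed

lemma nablaX_C01_eq_0:
  assumes A: "smooth_atlas A" and f: "f \<in> C01 A D" and x: "x \<notin> D"
  shows "nablaX A X f x = 0"
proof (rule nablaX_eq_0[OF A])
  let ?U = "- closure {x. f x \<noteq> 0}"
  show "open ?U" by blast
  show "x \<in> ?U" using f x unfolding C01_def by blast
  show "f z = 0" if "z \<in> ?U" for z
    using that closure_subset[of "{x. f x \<noteq> 0}"] by blast
qed

text \<open>Multiplied by their indicators, the two integrands are the same function; so the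
  nonintegrable case, where both integrals are 0 by convention, is covered too.\<close>

lemma set_lebesgue_integral_eq_subset:
  fixes f g :: "'a \<Rightarrow> 'b::{banach, second_countable_topology}"
  assumes "D \<subseteq> E" and "\<And>x. x \<in> D \<Longrightarrow> f x = g x" and "\<And>x. x \<notin> D \<Longrightarrow> f x = 0"
  shows "(LINT x:E|\<mu>. f x) = (LINT x:D|\<mu>. g x)"
  unfolding set_lebesgue_integral_def
  using assms by (intro Bochner_Integration.integral_cong) (auto simp: indicator_def)

text \<open>The sequence that represents the pair over \<open>D\<close> also represents its
  extension over \<open>E\<close>, as nothing in \<open>E - D\<close> contributes to the
  conditions.\<close>

lemma S0_extend_zero:
  assumes A: "smooth_atlas A" and DE: "D \<subseteq> E" and ug: "(u, g) \<in> S0 A X \<mu> p D"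
  shows "(\<lambda>x. indicator D x *\<^sub>R u x, \<lambda>x. indicator D x *\<^sub>R g x) \<in> S0 A X \<mu> p E"
proof -
  obtain f where meas: "set_borel_measurable \<mu> D u" "set_borel_measurable \<mu> D g"
    and f: "\<And>i. f i \<in> C01 A D" and cauchy: "Jp_Cauchy A X \<mu> p D f"
    and lim: "AE x in \<mu>. x \<in> D \<longrightarrow> (\<lambda>i. f i x) \<longlonglongrightarrow> u x"
    and grad: "(\<lambda>i. \<integral>\<^sup>+ x\<in>D. ennreal (norm (nablaX A X (f i) x - g x) powr p) \<partial>\<mu>) \<longlonglongrightarrow> 0"
    using ug by (auto simp: S0_def)
  \<comment> \<open>\<open>set_borel_measurable\<close> tests the function times the indicator, so
    this reduces measurability over \<open>E\<close> to that over \<open>D\<close>. It is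
    polymorphic to serve both \<open>u\<close> and \<open>g\<close>.\<close>
  have ind: "indicator E x *\<^sub>R indicator D x *\<^sub>R y = indicator D x *\<^sub>R y"
    for x and y :: "'z::real_vector"
    using DE by (auto simp: indicator_def)
  have "Jp A X \<mu> p E (\<lambda>x. f i x - f j x) = Jp A X \<mu> p D (\<lambda>x. f i x - f j x)" for i j
    unfolding Jp_def
    by (subst set_lebesgue_integral_eq_subset[OF DE refl])
      (simp_all add: nablaX_diff_C01_eq_0[OF A f f])
  then have "Jp_Cauchy A X \<mu> p E f"
    using cauchy by (simp add: Jp_Cauchy_def)
  moreover have "AE x in \<mu>. x \<in> E \<longrightarrow> (\<lambda>i. f i x) \<longlonglongrightarrow> indicator D x *\<^sub>R u x"
    using lim
  proof eventually_elim
    case (elim x)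
    \<comment> \<open>Off \<open>D\<close> the sequence is constantly 0, which is the value of the
      extension.\<close>
    then show ?case
      by (cases "x \<in> D") (simp_all add: C01_eq_0[OF f])
  qed
  \<comment> \<open>Off \<open>D\<close> the gradient and the extended \<open>g\<close> both vanish,
    and \<open>0 powr p = 0\<close>.\<close>
  moreover have "(\<integral>\<^sup>+ x\<in>E. ennreal (norm (nablaX A X (f i) x - indicator D x *\<^sub>R g x) powr p) \<partial>\<mu>) =
      (\<integral>\<^sup>+ x\<in>D. ennreal (norm (nablaX A X (f i) x - g x) powr p) \<partial>\<mu>)" for i
    using DE by (intro nn_integral_cong) (auto simp: indicator_def nablaX_C01_eq_0[OF A f])
  moreover have "f i \<in> C01 A E" for i
    using f C01_mono[OF DE] by blast
  moreover have "set_borel_measurable \<mu> E (\<lambda>x. indicator D x *\<^sub>R u x)"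
    "set_borel_measurable \<mu> E (\<lambda>x. indicator D x *\<^sub>R g x)"
    using meas by (simp_all only: set_borel_measurable_def ind)
  ultimately show ?thesis
    using grad unfolding S0_def by (auto intro!: exI[of _ f])
qed

lemma rayleigh_values_mono:
  assumes A: "smooth_atlas A" and DE: "D \<subseteq> E"
  shows "rayleigh_values A X \<mu> p D \<subseteq> rayleigh_values A X \<mu> p E"
proof
  fix r assume "r \<in> rayleigh_values A X \<mu> p D"
  then obtain u g where r: "r = (LINT x:D|\<mu>. norm (g x) powr p)"
    and ug: "(u, g) \<in> S0 A X \<mu> p D" and norm: "(LINT x:D|\<mu>. \<bar>u x\<bar> powr p) = 1"
    by (auto simp: rayleigh_values_def)
  \<comment> \<open>\<open>S0\<close> leaves the values off \<open>D\<close> arbitrary, so they are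
    cut off before integrating over \<open>E\<close>.\<close>
  let ?u = "\<lambda>x. indicator D x *\<^sub>R u x" and ?g = "\<lambda>x. indicator D x *\<^sub>R g x"
  have "(LINT x:E|\<mu>. norm (?g x) powr p) = r"
    unfolding r by (rule set_lebesgue_integral_eq_subset[OF DE]) simp_all
  moreover have "(LINT x:E|\<mu>. \<bar>?u x\<bar> powr p) = 1"
    unfolding norm[symmetric] by (rule set_lebesgue_integral_eq_subset[OF DE]) simp_all
  ultimately show "r \<in> rayleigh_values A X \<mu> p E"
    unfolding rayleigh_values_def mem_Collect_eq
    using S0_extend_zero[OF A DE ug] by (intro exI[of _ ?u] exI[of _ ?g]) simp
qed

theorem theorem2p5:
  fixes A :: "('m::{t2_space, second_countable_topology}, 'n::finite) chart set"
    and w :: "('m, 'n) chart \<Rightarrow> 'm \<Rightarrow> real"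
    and dx :: "'m measure"
    and X :: "('m, 'n, 'k::finite) vf_family"
    and p l l' :: real
    and \<Omega> \<Omega>' :: "'m set"
  assumes "smooth_atlas A"
    and "volume_form A w"
    and "volume_measure A w dx"
    and "CARD('k) \<le> CARD('n)"
    and "\<And>k. vector_field A (X k)"
    and "1 < p"
    and "open \<Omega>" and "open \<Omega>'"
    and "is_principal_frequency A X dx p \<Omega> l"
    and "is_principal_frequency A X dx p \<Omega>' l'"
    and "\<exists>u g. positive_eigenfunction A X dx p \<Omega> l u g"
    and "\<exists>u g. positive_eigenfunction A X dx p \<Omega>' l' u g"
    and "\<Omega> \<subseteq> \<Omega>'"
  shows "l \<ge> l'"
  \<comment> \<open>The minimum \<open>l\<close> is attained, hence is itself a Rayleigh value over
    \<open>\<Omega>'\<close>, and \<open>l'\<close> bounds all of these from below.\<close>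
  using rayleigh_values_mono[OF \<open>smooth_atlas A\<close> \<open>\<Omega> \<subseteq> \<Omega>'\<close>, of X dx p]
    \<open>is_principal_frequency A X dx p \<Omega> l\<close> \<open>is_principal_frequency A X dx p \<Omega>' l'\<close>
  unfolding is_principal_frequency_def by blast

end
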